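(* Let $\Omega,\mathcal H,\Gamma,t,T,L,C_i,C_j,\varepsilon_i,\varepsilon_j,\tau_i,\tau_j,B_i,B_j,P_i,P_j$ satisfy all the conditions of the common bi-Lipschitz random map setting described in the context. For a coupling $\pi$ of $P_i$ and $P_j$ (a Borel probability measure on $\mathcal H\times\mathcal H$ with marginals $P_i,P_j$), let $(B_i,B_j)\sim\pi$ and put $Z_i=\Gamma^{1/2}B_i$, $Z_j=\Gamma^{1/2}B_j$. Define $$v_i=\mathbb E\|Z_i\|^2,\quad v_j=\mathbb E\|Z_j\|^2,\quad \kappa_\pi=\mathbb E_\pi\langle Z_i,Z_j\rangle_{\mathcal H},\quad W_{2,\Gamma}^2(P_i,P_j)=\inf_{\pi}\mathbb E_\pi\|Z_i-Z_j\|^2,$$ where the infimum is over all couplings of $P_i$ and $P_j$, and $$\bar\kappa_{ij}=\tfrac12\bigl(v_i+v_j-W_{2,\Gamma}^2(P_i,P_j)\bigr).$$ Then for every coupling $\pi$ of $P_i$ and $P_j$, $$\kappa_\pi=\bar\kappa_{ij}-\tfrac12\Delta_\pi,\qquad \Delta_\pi:=\mathbb E_\pi\|Z_i-Z_j\|^2-W_{2,\Gamma}^2(P_i,P_j),$$ and $\Delta_\pi\ge 0$. Consequently $\bar\kappa_{ij}$ is the greatest covariance attainable by a coupling of the two exposure laws: every coupling $\pi$ satisfies $\kappa_\pi\le\bar\kappa_{ij}$, and there exists a coupling $\pi$ of $P_i$ and $P_j$ with $\kappa_\pi=\bar\kappa_{ij}$.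
   Context: Common bi-Lipschitz random map setting. $(\Omega,d_\Omega)$ is a Polish metric space with its Borel $\sigma$-algebra; $\mathcal P_2(\Omega)$ is the set of Borel probability measures $C$ on $\Omega$ with $\int_\Omega d_\Omega(\omega,\omega_0)^2\,C(d\omega)<\infty$ for some (equivalently any) $\omega_0\in\Omega$. $\mathcal H$ is a real separable Hilbert space; $\Gamma:\mathcal H\to\mathcal H$ is a bounded, positive, self-adjoint operator and $\Gamma^{1/2}$ is its unique bounded positive square root. The common carrier $t:\Omega\to\mathcal H$ is Borel measurable, and $t_\Gamma:=\Gamma^{1/2}\circ t$ is a Borel embedding with a Borel inverse on its image. For some $L\ge 1$ and all $x,y\in\Omega$, $$L^{-1}d_\Omega(x,y)\le\|t_\Gamma(x)-t_\Gamma(y)\|_{\mathcal H}\le L\,d_\Omega(x,y).$$ $\mathcal U$ is a measurable space and $T:\Omega\times\mathcal U\to\mathcal H$ is (Borel) measurable. $C_i,C_j\in\mathcal P_2(\Omega)$ are the characteristic laws of two firms $i,j$. For $k\in\{i,j\}$, $X_k\sim C_k$, $U_k$ is a $\mathcal U$-valued transmission draw with a law common to both firms, and the exposure random element is $$B_k=T(X_k,U_k)=t(X_k)+\varepsilon_k(X_k,U_k),$$ where $\varepsilon_k:\Omega\times\mathcal U\to\mathcal H$ is Borel measurable with $\|\Gamma^{1/2}\varepsilon_k(x,u)\|_{\mathcal H}\le\tau_k$ for all $(x,u)$, for a constant $\tau_k\ge0$. The exposure law is $P_k:=\mathcal L(B_k)$; equivalently $P_k=C_kK$ for the stochastic kernel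 $K(x,\cdot)=\mathcal L(T(x,U))$ with $U$ a transmission draw. It is assumed that $P_i,P_j\in\mathcal P_2(\mathcal H)$, i.e. $P_i$ and $P_j$ have finite second moment (hence also finite $\Gamma$-weighted second moment). *)

theory Defs
  imports "HOL-Probability.Probability"
begin

definition finite_second_moment :: "'a::metric_space measure set" where
  "finite_second_moment =
     {C. prob_space C \<and> sets C = sets borel \<and>
         (\<exists>x0. (\<integral>\<^sup>+ x. ennreal ((dist x x0)\<^sup>2) \<partial>C) < \<infinity>)}"

text \<open>On a real Hilbert space positivity of the quadratic form does not imply symmetry,
  so self-adjointness is stated separately.\<close>

definition pos_selfadjoint :: "('h::real_inner \<Rightarrow> 'h) \<Rightarrow> bool" where
  "pos_selfadjoint A \<longleftrightarrow>
     bounded_linear A \<and> (\<forall>x y. inner (A x) y = inner x (A y)) \<and> (\<forall>x. 0 \<le> inner (A x) x)"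

definition pos_sqrt :: "('h::real_inner \<Rightarrow> 'h) \<Rightarrow> ('h \<Rightarrow> 'h) \<Rightarrow> bool" where
  "pos_sqrt A S \<longleftrightarrow> pos_selfadjoint S \<and> (\<forall>x. S (S x) = A x)"

definition borel_embedding :: "('a::topological_space \<Rightarrow> 'b::topological_space) \<Rightarrow> bool" where
  "borel_embedding f \<longleftrightarrow>
     inj f \<and> f \<in> borel \<rightarrow>\<^sub>M borel \<and>
     the_inv f \<in> restrict_space borel (range f) \<rightarrow>\<^sub>M borel"

text \<open>The library's \<open>indep_var\<close> forces both random variables to take values in the same
  type, hence this heterogeneous version.\<close>

definition indep_rvs ::
  "'a measure \<Rightarrow> 'b measure \<Rightarrow> ('a \<Rightarrow> 'b) \<Rightarrow> 'c measure \<Rightarrow> ('a \<Rightarrow> 'c) \<Rightarrow> bool" where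
  "indep_rvs M N X N' Y \<longleftrightarrow>
     X \<in> M \<rightarrow>\<^sub>M N \<and> Y \<in> M \<rightarrow>\<^sub>M N' \<and>
     prob_space.indep_set M {X -` A \<inter> space M | A. A \<in> sets N} {Y -` A \<inter> space M | A. A \<in> sets N'}"

definition couplings ::
  "'a::topological_space measure \<Rightarrow> 'b::topological_space measure \<Rightarrow> ('a \<times> 'b) measure set" where
  "couplings P Q =
     {\<pi>. prob_space \<pi> \<and> sets \<pi> = sets borel \<and> distr \<pi> borel fst = P \<and> distr \<pi> borel snd = Q}"

text \<open>In the following, \<open>S\<close> is the square root of the weight operator, so that
  \<open>Z = S B\<close> for an exposure \<open>B\<close>. All expectations are Bochner integrals; they are
  meaningful when both marginals have finite second moment, since then the integrands are
  integrable under every coupling. The second moment of \<open>Z\<close> depends on a coupling only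
  through the marginal law of \<open>B\<close> and is written as an integral over that law.\<close>

definition weighted_second_moment :: "('h::real_inner \<Rightarrow> 'h) \<Rightarrow> 'h measure \<Rightarrow> real" where
  "weighted_second_moment S P = (\<integral>b. (norm (S b))\<^sup>2 \<partial>P)"

definition coupling_cov :: "('h::real_inner \<Rightarrow> 'h) \<Rightarrow> ('h \<times> 'h) measure \<Rightarrow> real" where
  "coupling_cov S \<pi> = (\<integral>(b, b'). inner (S b) (S b') \<partial>\<pi>)"

definition transport_cost :: "('h::real_inner \<Rightarrow> 'h) \<Rightarrow> ('h \<times> 'h) measure \<Rightarrow> real" where
  "transport_cost S \<pi> = (\<integral>(b, b'). (norm (S b - S b'))\<^sup>2 \<partial>\<pi>)"

definition weighted_W2_sq ::
  "('h::real_inner \<Rightarrow> 'h) \<Rightarrow> 'h measure \<Rightarrow> 'h measure \<Rightarrow> real" where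
  "weighted_W2_sq S P Q = (INF \<pi> \<in> couplings P Q. transport_cost S \<pi>)"

definition kappa_bar :: "('h::real_inner \<Rightarrow> 'h) \<Rightarrow> 'h measure \<Rightarrow> 'h measure \<Rightarrow> real" where
  "kappa_bar S P Q =
     (weighted_second_moment S P + weighted_second_moment S Q - weighted_W2_sq S P Q) / 2"

definition coupling_gap ::
  "('h::real_inner \<Rightarrow> 'h) \<Rightarrow> 'h measure \<Rightarrow> 'h measure \<Rightarrow> ('h \<times> 'h) measure \<Rightarrow> real" where
  "coupling_gap S P Q \<pi> = transport_cost S \<pi> - weighted_W2_sq S P Q"

end

theory Submission
  imports Defs
begin

text \<open>Expanding the square shows that the transport cost of a coupling is
  \<open>v\<^sub>i + v\<^sub>j\<close> minus twice its covariance, so only the existence of an optimal coupling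
  needs work. Given a minimizing sequence of couplings, Tychonoff's theorem yields a proper
  filter along which the mass of every set converges. Sets that, like their complements, are
  approximated from inside by compact sets uniformly over all couplings form an algebra; it contains
  all Borel rectangles because the marginals are tight. On this algebra the setwise limit is
  continuous at the empty set, hence extends to a coupling by Caratheodory's theorem. Convergence
  on rectangles gives convergence of the covariance for simple functions, and the approximation
  error in the general case is controlled by the marginals alone.\<close>

section \<open>Limits along a filter for arbitrary families of bounded sequences\<close>

text \<open>The index type may be uncountable, so no diagonal subsequence can serve all indices at
  once. Instead \<open>f\<close> has a cluster point in the compact box \<open>U\<close> of
  functions, and the neighbourhoods of that point, pulled back along \<open>f\<close>, give the
  filter.\<close>

lemma bounded_cluster_filter:
  fixes f :: "nat \<Rightarrow> 'i \<Rightarrow> real"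
  assumes "\<And>n i. f n i \<in> {a..b}"
  obtains G l where "G \<noteq> bot" "G \<le> sequentially" "\<And>i. ((\<lambda>n. f n i) \<longlongrightarrow> l i) G"
proof -
  define U where "U = (\<Pi>\<^sub>E i\<in>(UNIV::'i set). {a..b})"
  have "compactin (product_topology (\<lambda>i. euclidean) UNIV) U"
    unfolding U_def compactin_PiE by simp
  then have "compact U"
    unfolding euclidean_product_topology by simp
  moreover have "eventually (\<lambda>x. x \<in> U) (filtermap f sequentially)"
    using assms by (auto simp: eventually_filtermap U_def PiE_def)
  moreover have "filtermap f sequentially \<noteq> bot"
    by (simp add: filtermap_bot_iff)
  ultimately obtain l where l: "inf (nhds l) (filtermap f sequentially) \<noteq> bot"
    unfolding compact_filter by blast
  define G where "G = inf (filtercomap f (nhds l)) sequentially"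
  \<comment> \<open>If \<open>G\<close> were trivial, \<open>f\<close> would eventually avoid some
    neighbourhood \<open>R\<close> of \<open>l\<close>, contradicting the choice of \<open>l\<close>
    as a cluster point.\<close>
  have "G \<noteq> bot"
  proof
    assume "G = bot"
    then have "eventually (\<lambda>_. False) G" by simp
    then obtain P Q where PQ: "eventually P (filtercomap f (nhds l))" "eventually Q sequentially"
      "\<And>n. P n \<Longrightarrow> Q n \<Longrightarrow> False"
      unfolding G_def eventually_inf by auto
    then obtain R where R: "eventually R (nhds l)" "\<And>n. R (f n) \<Longrightarrow> P n"
      unfolding eventually_filtercomap by blast
    have "eventually (\<lambda>x. \<not> R x) (filtermap f sequentially)"
      unfolding eventually_filtermap using PQ(2) by eventually_elim (use PQ(3) R(2) in blast)
    then have "eventually (\<lambda>_. False) (inf (nhds l) (filtermap f sequentially))"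
      using R(1) unfolding eventually_inf by blast
    then show False using l by (simp add: trivial_limit_def)
  qed
  moreover have "G \<le> sequentially" unfolding G_def by simp
  moreover have "((\<lambda>n. f n i) \<longlongrightarrow> l i) G" for i
  proof -
    have "filterlim f (nhds l) G"
      unfolding G_def by (rule filterlim_mono[OF filterlim_filtercomap[of f "nhds l"]]) auto
    then show ?thesis
      using continuous_on_tendsto_compose[OF continuous_on_product_coordinates[of i]] by simp
  qed
  ultimately show ?thesis using that by blast
qed

section \<open>Uniform tightness and setwise limits of measures\<close>

text \<open>Inner regularity of a single set, with the compact set chosen independently of the
  measure. For \<open>R = UNIV\<close> this is the usual uniform tightness of
  \<open>\<C>\<close>.\<close>

definition uniformly_tight_in :: "'a::topological_space measure set \<Rightarrow> 'a set \<Rightarrow> bool" where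
  "uniformly_tight_in \<C> R \<longleftrightarrow> R \<in> sets borel \<and>
     (\<forall>e>0. \<exists>K. compact K \<and> K \<subseteq> R \<and> (\<forall>\<pi>\<in>\<C>. measure \<pi> (R - K) \<le> e))"

lemma uniformly_tight_in_empty: "uniformly_tight_in \<C> {}"
  unfolding uniformly_tight_in_def by (auto intro!: exI[of _ "{}"])

text \<open>What \<open>K \<union> L\<close> misses in \<open>R \<union> S\<close> and what
  \<open>K \<inter> L\<close> misses in \<open>R \<inter> S\<close> both lie in
  \<open>(R - K) \<union> (S - L)\<close>, so a tolerance of \<open>e / 2\<close> for each set
  suffices. In a Hausdorff space the intersection of two compact sets is again compact.\<close>

lemma uniformly_tight_in_Un_Int:
  fixes \<C> :: "'a::t2_space measure set"
  assumes "\<And>\<pi>. \<pi> \<in> \<C> \<Longrightarrow> prob_space \<pi>" "\<And>\<pi>. \<pi> \<in> \<C> \<Longrightarrow> sets \<pi> = sets borel"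
    and R: "uniformly_tight_in \<C> R" and S: "uniformly_tight_in \<C> S"
  shows "uniformly_tight_in \<C> (R \<union> S)" "uniformly_tight_in \<C> (R \<inter> S)"
proof -
  have RS: "R \<in> sets borel" "S \<in> sets borel"
    using R S by (auto simp: uniformly_tight_in_def)
  have *: "\<exists>K L. compact K \<and> K \<subseteq> R \<and> compact L \<and> L \<subseteq> S \<and>
    (\<forall>\<pi>\<in>\<C>. measure \<pi> ((R \<union> S) - (K \<union> L)) \<le> e \<and> measure \<pi> ((R \<inter> S) - (K \<inter> L)) \<le> e)"
    if "e > 0" for e
  proof -
    have "e / 2 > 0" using that by simp
    then obtain K L where KL: "compact K" "K \<subseteq> R" "\<And>\<pi>. \<pi> \<in> \<C> \<Longrightarrow> measure \<pi> (R - K) \<le> e / 2"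
       "compact L" "L \<subseteq> S" "\<And>\<pi>. \<pi> \<in> \<C> \<Longrightarrow> measure \<pi> (S - L) \<le> e / 2"
      using R S unfolding uniformly_tight_in_def by meson
    have "measure \<pi> X \<le> e" if "\<pi> \<in> \<C>" "X \<subseteq> (R - K) \<union> (S - L)" for \<pi> X
    proof -
      interpret prob_space \<pi> using assms that by blast
      have s: "R - K \<in> sets \<pi>" "S - L \<in> sets \<pi>"
        unfolding assms(2)[OF that(1)] using RS KL(1,4) by (blast intro: borel_compact)+
      have "measure \<pi> X \<le> measure \<pi> ((R - K) \<union> (S - L))"
        using that s by (intro finite_measure_mono) auto
      also have "\<dots> \<le> measure \<pi> (R - K) + measure \<pi> (S - L)"
        using s by (rule measure_Un_le)
      also have "\<dots> \<le> e" using KL(3,6)[OF that(1)] by simp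
      finally show ?thesis .
    qed
    then show ?thesis using KL(1,2,4,5)
      by (intro exI[of _ K] exI[of _ L]) (auto simp: subset_iff)
  qed
  show "uniformly_tight_in \<C> (R \<union> S)"
    unfolding uniformly_tight_in_def
  proof (intro conjI allI impI)
    fix e :: real assume "e > 0"
    from *[OF this] obtain K L where "compact K" "K \<subseteq> R" "compact L" "L \<subseteq> S"
      "\<forall>\<pi>\<in>\<C>. measure \<pi> ((R \<union> S) - (K \<union> L)) \<le> e" by blast
    then show "\<exists>K. compact K \<and> K \<subseteq> R \<union> S \<and> (\<forall>\<pi>\<in>\<C>. measure \<pi> (R \<union> S - K) \<le> e)"
      by (intro exI[of _ "K \<union> L"]) auto
  qed (use RS in auto)
  show "uniformly_tight_in \<C> (R \<inter> S)"
    unfolding uniformly_tight_in_def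
  proof (intro conjI allI impI)
    fix e :: real assume "e > 0"
    from *[OF this] obtain K L where "compact K" "K \<subseteq> R" "compact L" "L \<subseteq> S"
      "\<forall>\<pi>\<in>\<C>. measure \<pi> ((R \<inter> S) - (K \<inter> L)) \<le> e" by blast
    then show "\<exists>K. compact K \<and> K \<subseteq> R \<inter> S \<and> (\<forall>\<pi>\<in>\<C>. measure \<pi> (R \<inter> S - K) \<le> e)"
      by (intro exI[of _ "K \<inter> L"]) (auto intro: compact_Int)
  qed (use RS in auto)
qed

text \<open>Compact inner approximations \<open>K k\<close> have empty intersection, hence so do
  finitely many of them, by the finite intersection property. A late \<open>R k\<close> is then
  covered by what those finitely many miss. They are chosen uniformly over \<open>\<C>\<close>,
  which makes \<open>N\<close> the same for all measures.\<close>

lemma uniformly_tight_in_decseq_small: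
  fixes \<C> :: "'a::t2_space measure set"
  assumes \<C>: "\<And>\<pi>. \<pi> \<in> \<C> \<Longrightarrow> prob_space \<pi>" "\<And>\<pi>. \<pi> \<in> \<C> \<Longrightarrow> sets \<pi> = sets borel"
    and R: "\<And>k::nat. uniformly_tight_in \<C> (R k)" and "decseq R" "(\<Inter>k. R k) = {}" and "e > 0"
  obtains N where "\<And>\<pi> k. \<pi> \<in> \<C> \<Longrightarrow> k \<ge> N \<Longrightarrow> measure \<pi> (R k) \<le> e"
proof -
  \<comment> \<open>The tolerances \<open>e * (1/2) ^ Suc k\<close> sum to less than
    \<open>e\<close> over any finite range of \<open>k\<close>.\<close>
  have "\<forall>k. \<exists>K. compact K \<and> K \<subseteq> R k \<and> (\<forall>\<pi>\<in>\<C>. measure \<pi> (R k - K) \<le> e * (1/2) ^ Suc k)"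
  proof
    fix k
    have "e * (1/2) ^ Suc k > 0" using \<open>e > 0\<close> by simp
    then show "\<exists>K. compact K \<and> K \<subseteq> R k \<and> (\<forall>\<pi>\<in>\<C>. measure \<pi> (R k - K) \<le> e * (1/2) ^ Suc k)"
      using R[of k] unfolding uniformly_tight_in_def by blast
  qed
  then obtain K where K: "\<And>k. compact (K k)" "\<And>k. K k \<subseteq> R k"
    "\<And>k \<pi>. \<pi> \<in> \<C> \<Longrightarrow> measure \<pi> (R k - K k) \<le> e * (1/2) ^ Suc k"
    by metis
  have Rb: "R k \<in> sets borel" for k using R by (auto simp: uniformly_tight_in_def)
  have "\<exists>N. (\<Inter>k\<le>N. K k) = {}"
  proof (rule ccontr)
    assume "\<nexists>N. (\<Inter>k\<le>N. K k) = {}"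
    then have ne: "(\<Inter>k\<le>N. K k) \<noteq> {}" for N by blast
    \<comment> \<open>\<open>K 0\<close> is split off as the compact set; the whole family then
      enters as closed sets.\<close>
    have "K 0 \<inter> (\<Inter>k\<in>UNIV. K k) \<noteq> {}"
    proof (rule compact_imp_fip_image)
      fix I :: "nat set" assume "finite I" "I \<subseteq> UNIV"
      then obtain N where "I \<subseteq> {..N}"
        using finite_nat_iff_bounded_le by blast
      then have "(\<Inter>k\<le>N. K k) \<subseteq> K 0 \<inter> (\<Inter>k\<in>I. K k)" by auto
      then show "K 0 \<inter> (\<Inter>k\<in>I. K k) \<noteq> {}" using ne[of N] by blast
    qed (use K(1) in \<open>blast intro: compact_imp_closed\<close>)+
    moreover have "(\<Inter>k. K k) \<subseteq> (\<Inter>k. R k)" by (rule INT_anti_mono) (use K(2) in auto)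
    ultimately show False using assms(5) by auto
  qed
  then obtain N where N: "(\<Inter>k\<le>N. K k) = {}" by blast
  have "measure \<pi> (R k) \<le> e" if "\<pi> \<in> \<C>" "k \<ge> N" for \<pi> k
  proof -
    interpret prob_space \<pi> using \<C> that by blast
    have s: "R j - K j \<in> sets \<pi>" for j
      unfolding \<C>(2)[OF that(1)] by (rule sets.Diff[OF Rb borel_compact[OF K(1)]])
    \<comment> \<open>A point of \<open>R k\<close> lies in every \<open>R j\<close> with
      \<open>j \<le> N\<close>, since \<open>R\<close> decreases, and some such \<open>K j\<close>
      misses it.\<close>
    have "R k \<subseteq> (\<Union>j\<le>N. R j - K j)"
    proof
      fix x assume "x \<in> R k"
      moreover obtain j where "j \<le> N" "x \<notin> K j" using N by blast
      ultimately show "x \<in> (\<Union>j\<le>N. R j - K j)"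
        using decseqD[OF \<open>decseq R\<close>, of j k] that by auto
    qed
    then have "measure \<pi> (R k) \<le> measure \<pi> (\<Union>j\<le>N. R j - K j)"
      using s by (intro finite_measure_mono) auto
    also have "\<dots> \<le> (\<Sum>j\<le>N. measure \<pi> (R j - K j))"
      using s by (intro measure_UNION_le) auto
    also have "\<dots> \<le> (\<Sum>j\<le>N. e * (1/2) ^ Suc j)"
      by (intro sum_mono K that)
    also have "\<dots> = e * (1 - (1/2) ^ Suc N)"
      by (induction N) (auto simp: algebra_simps)
    also have "\<dots> \<le> e" using \<open>e > 0\<close> by (simp add: mult_le_cancel_left1)
    finally show ?thesis .
  qed
  then show ?thesis using that by blast
qed

text \<open>A setwise limit of probability measures is in general only finitely additive; countable
  additivity is recovered on the algebra \<open>\<A>\<close> from uniform tightness. Away from that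
  algebra \<open>\<mu>\<close> may differ from \<open>m\<close>, so agreement is claimed on the
  generators.\<close>

lemma uniformly_tight_setwise_limit:
  fixes \<C> :: "'a::t2_space measure set" and \<pi> :: "nat \<Rightarrow> 'a measure"
  assumes \<C>: "\<And>\<pi>. \<pi> \<in> \<C> \<Longrightarrow> prob_space \<pi>" "\<And>\<pi>. \<pi> \<in> \<C> \<Longrightarrow> sets \<pi> = sets borel"
    and \<pi>: "\<And>n. \<pi> n \<in> \<C>"
    and "G \<noteq> bot"
    and lim: "\<And>A. ((\<lambda>n. measure (\<pi> n) A) \<longlongrightarrow> m A) G"
    and gen: "sigma_sets UNIV \<R> = sets borel"
    and tight: "\<And>A. A \<in> \<R> \<Longrightarrow> uniformly_tight_in \<C> A"
      "\<And>A. A \<in> \<R> \<Longrightarrow> uniformly_tight_in \<C> (- A)"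
    and compact_univ: "uniformly_tight_in \<C> UNIV"
  obtains \<mu> where "prob_space \<mu>" "sets \<mu> = sets borel" "\<And>A. A \<in> \<R> \<Longrightarrow> measure \<mu> A = m A"
proof -
  \<comment> \<open>Requiring the property of both \<open>A\<close> and \<open>- A\<close> builds in
    closure under complements; the remaining algebra laws come from
    \<open>uniformly_tight_in_Un_Int\<close>.\<close>
  define \<A> where "\<A> = {A. uniformly_tight_in \<C> A \<and> uniformly_tight_in \<C> (- A)}"
  interpret A: algebra UNIV \<A>
    unfolding algebra_iff_Un using uniformly_tight_in_Un_Int[OF \<C>] compact_univ
    by (auto simp: \<A>_def uniformly_tight_in_empty Compl_eq_Diff_UNIV[symmetric])
  have \<A>_borel: "\<A> \<subseteq> sets borel" by (auto simp: \<A>_def uniformly_tight_in_def)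
  have \<R>_sub: "\<R> \<subseteq> \<A>" using tight by (auto simp: \<A>_def)
  have sig: "sigma_sets UNIV \<A> = sets borel"
  proof
    show "sigma_sets UNIV \<A> \<subseteq> sets borel"
      using \<A>_borel sets.sigma_sets_subset[of \<A> borel] by simp
    show "sets borel \<subseteq> sigma_sets UNIV \<A>"
      using \<R>_sub gen sigma_sets_mono'[of \<R> \<A>] by auto
  qed
  have m_nonneg: "m A \<ge> 0" for A
    by (rule tendsto_lowerbound[OF lim _ \<open>G \<noteq> bot\<close>]) auto
  have m_le: "m A \<le> e" if "\<And>n. measure (\<pi> n) A \<le> e" for A e
    by (rule tendsto_upperbound[OF lim _ \<open>G \<noteq> bot\<close>]) (use that in auto)
  have m_empty: "m {} = 0" using m_le[of "{}" 0] m_nonneg[of "{}"] by simp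
  have m_add: "m (A \<union> B) = m A + m B" if "A \<in> sets borel" "B \<in> sets borel" "A \<inter> B = {}" for A B
  proof (rule tendsto_unique[OF \<open>G \<noteq> bot\<close> lim])
    have "measure (\<pi> n) (A \<union> B) = measure (\<pi> n) A + measure (\<pi> n) B" for n
    proof -
      interpret prob_space "\<pi> n" using \<C> \<pi> by blast
      show ?thesis using that \<C>(2)[OF \<pi>[of n]] by (intro finite_measure_Union) auto
    qed
    then show "((\<lambda>n. measure (\<pi> n) (A \<union> B)) \<longlongrightarrow> m A + m B) G"
      using lim by (auto intro: tendsto_add)
  qed
  have "\<exists>\<mu>. (\<forall>s\<in>\<A>. \<mu> s = ennreal (m s)) \<and> measure_space UNIV (sigma_sets UNIV \<A>) \<mu>"
  proof (rule A.caratheodory_empty_continuous)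
    show "positive \<A> (\<lambda>A. ennreal (m A))" by (simp add: positive_def m_empty)
    show "additive \<A> (\<lambda>A. ennreal (m A))"
      unfolding additive_def using m_add \<A>_borel m_nonneg by (auto simp: subset_iff)
    fix R :: "nat \<Rightarrow> 'a set" assume R: "range R \<subseteq> \<A>" "decseq R" "(\<Inter>i. R i) = {}"
    have "(\<lambda>i. m (R i)) \<longlonglongrightarrow> 0"
    proof (rule LIMSEQ_I)
      fix r :: real assume "r > 0"
      \<comment> \<open>Half of \<open>r\<close>, because the limit along \<open>G\<close> preserves
        only non-strict bounds.\<close>
      then have "r / 2 > 0" by simp
      moreover have "uniformly_tight_in \<C> (R k)" for k using R(1) by (auto simp: \<A>_def)
      ultimately obtain N where "\<And>p k. p \<in> \<C> \<Longrightarrow> k \<ge> N \<Longrightarrow> measure p (R k) \<le> r / 2"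
        using uniformly_tight_in_decseq_small[OF \<C> _ R(2,3), where e = "r / 2"] by metis
      \<comment> \<open>Since \<open>N\<close> serves every measure in \<open>\<C>\<close>, the
        bound holds for all \<open>\<pi> n\<close> at once and passes to \<open>m\<close>.\<close>
      then have "m (R k) \<le> r / 2" if "k \<ge> N" for k using \<pi> that by (intro m_le) auto
      then show "\<exists>N. \<forall>n\<ge>N. norm (m (R n) - 0) < r"
        using m_nonneg \<open>r > 0\<close> by (intro exI[of _ N]) fastforce
    qed
    then show "(\<lambda>i. ennreal (m (R i))) \<longlonglongrightarrow> 0"
      using tendsto_ennrealI by fastforce
  qed auto
  then obtain \<mu> where \<mu>: "\<And>s. s \<in> \<A> \<Longrightarrow> \<mu> s = ennreal (m s)" "measure_space UNIV (sets borel) \<mu>"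
    unfolding sig by blast
  define M where "M = measure_of UNIV (sets borel) \<mu>"
  have sM: "sets M = sets borel"
    unfolding M_def using sets.sigma_sets_eq[of "borel :: 'a measure"] by simp
  have emeasure: "emeasure M s = ennreal (m s)" if "s \<in> \<A>" for s
  proof -
    have "emeasure M s = \<mu> s"
      unfolding M_def using \<mu>(2) that \<A>_borel
      by (intro emeasure_measure_of_sigma) (auto simp: measure_space_def)
    then show ?thesis using \<mu>(1) that by simp
  qed
  show ?thesis
  proof (rule that[OF _ sM])
    have "m UNIV = 1"
    proof (rule tendsto_unique[OF \<open>G \<noteq> bot\<close> lim])
      have "measure (\<pi> n) UNIV = 1" for n
        using prob_space.prob_space[OF \<C>(1)[OF \<pi>[of n]]] sets_eq_imp_space_eq[OF \<C>(2)[OF \<pi>[of n]]]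
        by simp
      then show "((\<lambda>n. measure (\<pi> n) UNIV) \<longlongrightarrow> 1) G" by simp
    qed
    then show "prob_space M"
      using emeasure[OF A.top] sets_eq_imp_space_eq[OF sM] by (intro prob_spaceI) simp
    show "measure M A = m A" if "A \<in> \<R>" for A
      using emeasure[of A] that \<R>_sub m_nonneg by (auto simp: measure_def)
  qed
qed

section \<open>Couplings and their marginals\<close>

lemma couplingsD:
  assumes "\<pi> \<in> couplings P Q"
  shows "prob_space \<pi>" "sets \<pi> = sets borel" "distr \<pi> borel fst = P" "distr \<pi> borel snd = Q"
  using assms by (auto simp: couplings_def)

lemma measurable_couplings:
  fixes \<pi> :: "('a::second_countable_topology \<times> 'b::second_countable_topology) measure"
  assumes "\<pi> \<in> couplings P Q"
  shows "fst \<in> \<pi> \<rightarrow>\<^sub>M borel" "snd \<in> \<pi> \<rightarrow>\<^sub>M borel"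
  using couplingsD(2)[OF assms] by (simp_all add: borel_prod[symmetric] cong: measurable_cong_sets)

lemma measure_couplings:
  fixes \<pi> :: "('a::second_countable_topology \<times> 'b::second_countable_topology) measure"
  assumes \<pi>: "\<pi> \<in> couplings P Q"
  shows "A \<in> sets borel \<Longrightarrow> measure \<pi> (A \<times> UNIV) = measure P A"
    and "B \<in> sets borel \<Longrightarrow> measure \<pi> (UNIV \<times> B) = measure Q B"
proof -
  have sp: "space \<pi> = UNIV" using sets_eq_imp_space_eq[OF couplingsD(2)[OF \<pi>]] by simp
  show "measure \<pi> (A \<times> UNIV) = measure P A" if "A \<in> sets borel"
    using measure_distr[OF measurable_couplings(1)[OF \<pi>] that] couplingsD(3)[OF \<pi>]
    by (simp add: sp vimage_fst)
  show "measure \<pi> (UNIV \<times> B) = measure Q B" if "B \<in> sets borel"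
    using measure_distr[OF measurable_couplings(2)[OF \<pi>] that] couplingsD(4)[OF \<pi>]
    by (simp add: sp vimage_snd)
qed

lemma integral_couplings:
  fixes \<pi> :: "('a::second_countable_topology \<times> 'b::second_countable_topology) measure"
    and f :: "'a \<Rightarrow> real" and g :: "'b \<Rightarrow> real"
  assumes \<pi>: "\<pi> \<in> couplings P Q"
  shows "integrable P f \<Longrightarrow> f \<in> borel_measurable borel \<Longrightarrow> integrable \<pi> (\<lambda>z. f (fst z))"
    and "integrable Q g \<Longrightarrow> g \<in> borel_measurable borel \<Longrightarrow> integrable \<pi> (\<lambda>z. g (snd z))"
    and "f \<in> borel_measurable borel \<Longrightarrow> (\<integral>z. f (fst z) \<partial>\<pi>) = (\<integral>x. f x \<partial>P)"
    and "g \<in> borel_measurable borel \<Longrightarrow> (\<integral>z. g (snd z) \<partial>\<pi>) = (\<integral>x. g x \<partial>Q)"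
  using couplingsD(3,4)[OF \<pi>] measurable_couplings[OF \<pi>]
  by (auto simp: integrable_distr_eq[symmetric] integral_distr[symmetric])

text \<open>Ensures that the infimum of the transport cost is taken over a nonempty set.\<close>

lemma pair_measure_in_couplings:
  fixes P :: "'a::second_countable_topology measure" and Q :: "'b::second_countable_topology measure"
  assumes "prob_space P" "sets P = sets borel" "prob_space Q" "sets Q = sets borel"
  shows "P \<Otimes>\<^sub>M Q \<in> couplings P Q"
proof -
  interpret P: prob_space P by fact
  interpret Q: prob_space Q by fact
  interpret PQ: pair_prob_space P Q ..
  have "distr (P \<Otimes>\<^sub>M Q) borel fst = distr (P \<Otimes>\<^sub>M Q) P fst"
    using assms by (intro distr_cong) auto
  moreover have "distr (P \<Otimes>\<^sub>M Q) borel snd = distr (P \<Otimes>\<^sub>M Q) Q snd"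
    using assms by (intro distr_cong) auto
  moreover have "sets (P \<Otimes>\<^sub>M Q) = sets borel"
    unfolding borel_prod[symmetric] using assms by (intro sets_pair_measure_cong) auto
  moreover have "distr (P \<Otimes>\<^sub>M Q) P fst = P" 
    by (rule Q.distr_pair_fst)
  moreover have "distr (P \<Otimes>\<^sub>M Q) Q snd = Q"
  proof (rule measure_eqI)
    fix A assume "A \<in> sets (distr (P \<Otimes>\<^sub>M Q) Q snd)"
    then have A: "A \<in> sets Q" by simp
    have "snd -` A \<inter> space (P \<Otimes>\<^sub>M Q) = space P \<times> A"
      using sets.sets_into_space[OF A] by (auto simp: space_pair_measure)
    then show "emeasure (distr (P \<Otimes>\<^sub>M Q) Q snd) A = emeasure Q A"
      using A by (simp add: emeasure_distr Q.emeasure_pair_measure_Times P.emeasure_space_1)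
  qed simp
  ultimately show ?thesis
    unfolding couplings_def using PQ.prob_space_axioms by simp
qed

section \<open>Compactness of the set of couplings\<close>

lemma polish_tight:
  fixes P :: "'a::polish_space measure"
  assumes "prob_space P" "sets P = sets borel" "A \<in> sets borel" "e > 0"
  obtains K where "compact K" "K \<subseteq> A" "measure P (A - K) \<le> e"
proof -
  interpret prob_space P by fact
  show ?thesis
  \<comment> \<open>If \<open>A\<close> has mass at most \<open>e\<close>, the empty set will do.
    Otherwise \<open>measure P A - e\<close> is nonnegative, so strict inequalities transfer between
    the reals and \<open>ennreal\<close>.\<close>
  proof (cases "measure P A \<le> e")
    case True
    then show ?thesis using that[of "{}"] by simp
  next
    case False
    have "ennreal (measure P A - e) < emeasure P A"
      using False \<open>e > 0\<close> by (simp add: emeasure_eq_measure ennreal_less_iff)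
    also have "\<dots> = (SUP K \<in> {K. K \<subseteq> A \<and> compact K}. emeasure P K)"
      using assms by (intro inner_regular) (auto simp: emeasure_space_1)
    finally obtain K where K: "K \<subseteq> A" "compact K" "ennreal (measure P A - e) < emeasure P K"
      unfolding less_SUP_iff by blast
    have "K \<in> sets P" "A \<in> sets P" using assms borel_compact K by auto
    then have "measure P (A - K) = measure P A - measure P K"
      using K by (intro finite_measure_Diff) auto
    moreover have "measure P A - e < measure P K"
      using K(3) False by (simp add: emeasure_eq_measure ennreal_less_iff)
    ultimately show ?thesis using that K by force
  qed
qed

text \<open>The part of \<open>A \<times> B\<close> outside \<open>K \<times> L\<close> lies over
  \<open>A - K\<close> or over \<open>B - L\<close>, and the mass of these strips is prescribed by
  the marginals, hence equal for all couplings.\<close>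

lemma couplings_uniformly_tight_in_Times:
  fixes P :: "'a::polish_space measure" and Q :: "'b::polish_space measure"
  assumes P: "prob_space P" "sets P = sets borel" and Q: "prob_space Q" "sets Q = sets borel"
    and A: "A \<in> sets borel" and B: "B \<in> sets borel"
  shows "uniformly_tight_in (couplings P Q) (A \<times> B)"
  unfolding uniformly_tight_in_def
proof (intro conjI allI impI)
  show "A \<times> B \<in> sets borel" using A B unfolding borel_prod[symmetric] by auto
  fix e :: real assume "e > 0"
  then have e2: "e / 2 > 0" by simp
  obtain K where K: "compact K" "K \<subseteq> A" "measure P (A - K) \<le> e / 2"
    using polish_tight[OF P A e2] .
  obtain L where L: "compact L" "L \<subseteq> B" "measure Q (B - L) \<le> e / 2"
    using polish_tight[OF Q B e2] .
  have bor: "A - K \<in> sets borel" "B - L \<in> sets borel" using A B K L borel_compact by auto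
  have "measure \<pi> (A \<times> B - K \<times> L) \<le> e" if \<pi>: "\<pi> \<in> couplings P Q" for \<pi>
  proof -
    interpret prob_space \<pi> using couplingsD[OF \<pi>] by blast
    have s: "(A - K) \<times> UNIV \<in> sets \<pi>" "UNIV \<times> (B - L) \<in> sets \<pi>"
      using bor unfolding couplingsD(2)[OF \<pi>] borel_prod[symmetric] by auto
    have "measure \<pi> (A \<times> B - K \<times> L) \<le> measure \<pi> ((A - K) \<times> UNIV \<union> UNIV \<times> (B - L))"
      using s by (intro finite_measure_mono) auto
    also have "\<dots> \<le> measure \<pi> ((A - K) \<times> UNIV) + measure \<pi> (UNIV \<times> (B - L))"
      using s by (rule measure_Un_le)
    also have "\<dots> \<le> e" using K L bor by (simp add: measure_couplings[OF \<pi>])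
    finally show ?thesis .
  qed
  then show "\<exists>K. compact K \<and> K \<subseteq> A \<times> B \<and> (\<forall>\<pi>\<in>couplings P Q. measure \<pi> (A \<times> B - K) \<le> e)"
    using K L by (intro exI[of _ "K \<times> L"]) (auto intro: compact_Times)
qed

text \<open>Compactness of the set of couplings, with convergence tested on Borel rectangles instead
  of continuous functions. Merely Borel integrands can then be treated through simple
  functions.\<close>

lemma couplings_cluster_point:
  fixes P :: "'a::polish_space measure" and Q :: "'b::polish_space measure"
  assumes P: "prob_space P" "sets P = sets borel" and Q: "prob_space Q" "sets Q = sets borel"
    and \<pi>: "\<And>n::nat. \<pi> n \<in> couplings P Q"
  obtains G \<mu> where "G \<noteq> bot" "G \<le> sequentially" "\<mu> \<in> couplings P Q"
    "\<forall>A\<in>sets borel. \<forall>B\<in>sets borel.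
       ((\<lambda>n. measure (\<pi> n) (A \<times> B)) \<longlongrightarrow> measure \<mu> (A \<times> B)) G"
proof -
  \<comment> \<open>The index \<open>A\<close> runs over all sets; a nonmeasurable one has the
    default measure 0 throughout.\<close>
  have "measure (\<pi> n) A \<in> {0..1}" for n A
    using prob_space.prob_le_1[OF couplingsD(1)[OF \<pi>]] by simp
  then obtain G m where G: "G \<noteq> bot" "G \<le> sequentially"
    "\<And>A. ((\<lambda>n. measure (\<pi> n) A) \<longlongrightarrow> m A) G"
    using bounded_cluster_filter[of "\<lambda>n A. measure (\<pi> n) A" 0 1] by blast
  define \<R> where "\<R> = {A \<times> B |(A::'a set) (B::'b set). A \<in> sets borel \<and> B \<in> sets borel}"
  have gen: "sigma_sets UNIV \<R> = sets borel"
    unfolding \<R>_def borel_prod[symmetric] sets_pair_measure by simp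
  note tight = couplings_uniformly_tight_in_Times[OF P Q]
  have tight_compl: "uniformly_tight_in (couplings P Q) (- (A \<times> B))"
    if "A \<in> sets borel" "B \<in> sets borel" for A B
  proof -
    \<comment> \<open>The complement of a rectangle is a union of two strips, which are rectangles
      themselves.\<close>
    have "- (A \<times> B) = (- A) \<times> UNIV \<union> UNIV \<times> (- B)" by auto
    then show ?thesis using that by (auto intro!: uniformly_tight_in_Un_Int(1) tight dest: couplingsD)
  qed
  have "UNIV \<times> UNIV = (UNIV :: ('a \<times> 'b) set)" by simp
  then have tight_UNIV: "uniformly_tight_in (couplings P Q) UNIV"
    using tight[of UNIV UNIV] by simp
  obtain \<mu> where \<mu>: "prob_space \<mu>" "sets \<mu> = sets borel" "\<And>A. A \<in> \<R> \<Longrightarrow> measure \<mu> A = m A"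
    by (rule uniformly_tight_setwise_limit[OF couplingsD(1,2) \<pi> G(1,3) gen _ _ tight_UNIV])
       (auto simp: \<R>_def intro: tight tight_compl)
  have m: "measure \<mu> (A \<times> B) = m (A \<times> B)" if "A \<in> sets borel" "B \<in> sets borel" for A B
    using \<mu>(3) that by (auto simp: \<R>_def)
  have meas: "fst \<in> \<mu> \<rightarrow>\<^sub>M borel" "snd \<in> \<mu> \<rightarrow>\<^sub>M borel"
    using \<mu>(2) by (simp_all add: borel_prod[symmetric] cong: measurable_cong_sets)
  have sp: "space \<mu> = UNIV" using sets_eq_imp_space_eq[OF \<mu>(2)] by simp
  interpret \<mu>: prob_space \<mu> by fact
  interpret P: prob_space P by fact
  interpret Q: prob_space Q by fact
  \<comment> \<open>Every \<open>\<pi> n\<close> gives the strip \<open>A \<times> UNIV\<close> the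
    mass \<open>measure P A\<close>, so the limit does too; likewise for the other marginal.\<close>
  have "distr \<mu> borel fst = P"
  proof (rule measure_eqI)
    fix A assume "A \<in> sets (distr \<mu> borel fst)"
    then have A: "A \<in> sets borel" by simp
    have "((\<lambda>n. measure (\<pi> n) (A \<times> UNIV)) \<longlongrightarrow> measure P A) G"
      using measure_couplings(1)[OF \<pi> A] by simp
    then have "m (A \<times> UNIV) = measure P A" using tendsto_unique[OF G(1,3)] by blast
    then have "measure \<mu> (A \<times> UNIV) = measure P A" using m[OF A, of UNIV] by simp
    then show "emeasure (distr \<mu> borel fst) A = emeasure P A"
      using A meas by (simp add: emeasure_distr sp vimage_fst \<mu>.emeasure_eq_measure P.emeasure_eq_measure)
  qed (use P in simp)
  moreover have "distr \<mu> borel snd = Q"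
  proof (rule measure_eqI)
    fix B assume "B \<in> sets (distr \<mu> borel snd)"
    then have B: "B \<in> sets borel" by simp
    have "((\<lambda>n. measure (\<pi> n) (UNIV \<times> B)) \<longlongrightarrow> measure Q B) G"
      using measure_couplings(2)[OF \<pi> B] by simp
    then have "m (UNIV \<times> B) = measure Q B" using tendsto_unique[OF G(1,3)] by blast
    then have "measure \<mu> (UNIV \<times> B) = measure Q B" using m[OF _ B, of UNIV] by simp
    then show "emeasure (distr \<mu> borel snd) B = emeasure Q B"
      using B meas by (simp add: emeasure_distr sp vimage_snd \<mu>.emeasure_eq_measure Q.emeasure_eq_measure)
  qed (use Q in simp)
  ultimately have \<mu>_cpl: "\<mu> \<in> couplings P Q" using \<mu>(1,2) by (simp add: couplings_def)
  show ?thesis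
    by (rule that[OF G(1,2) \<mu>_cpl]) (simp add: m G(3))
qed

section \<open>Convergence of the covariance\<close>

text \<open>Dominated convergence for the squared errors of a pointwise approximation by simple
  functions. The bound by \<open>2 * norm (f x)\<close> supplies the dominating function, and later
  it controls a cross term by the second moment of \<open>f\<close>.\<close>

lemma simple_function_L2_approx:
  fixes f :: "'a::topological_space \<Rightarrow> 'h::{real_inner, second_countable_topology}"
  assumes P: "sets P = sets borel" and f: "f \<in> borel_measurable borel"
    and int: "integrable P (\<lambda>x. (norm (f x))\<^sup>2)" and "e > 0"
  obtains s where "simple_function borel s" "\<And>x. norm (s x) \<le> 2 * norm (f x)"
    "(\<integral>x. (norm (f x - s x))\<^sup>2 \<partial>P) \<le> e"
proof -
  obtain F where F: "\<And>i. simple_function borel (F i)" "\<And>x. (\<lambda>i. F i x) \<longlonglongrightarrow> f x"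
    "\<And>i x. norm (F i x) \<le> 2 * norm (f x)"
    using borel_measurable_implies_sequence_metric[OF f, of 0]
    unfolding space_borel dist_0_norm dist_norm diff_zero by blast
  have [measurable]: "f \<in> borel_measurable P" "F i \<in> borel_measurable P" for i
    using f borel_measurable_simple_function[OF F(1)] unfolding measurable_cong_sets[OF P refl]
    by blast+
  have "(\<lambda>i. \<integral>x. (norm (f x - F i x))\<^sup>2 \<partial>P) \<longlonglongrightarrow> (\<integral>x. 0 \<partial>P)"
  proof (rule integral_dominated_convergence)
    \<comment> \<open>The error \<open>norm (f x - F i x)\<close> is at most
      \<open>3 * norm (f x)\<close>, whence the factor 9.\<close>
    show "integrable P (\<lambda>x. 9 * (norm (f x))\<^sup>2)" using int by simp
    have "(\<lambda>i. (norm (f x - F i x))\<^sup>2) \<longlonglongrightarrow> (norm (f x - f x))\<^sup>2" for x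
      by (intro tendsto_intros F)
    then show "AE x in P. (\<lambda>i. (norm (f x - F i x))\<^sup>2) \<longlonglongrightarrow> 0" by simp
    have "(norm (f x - F i x))\<^sup>2 \<le> 9 * (norm (f x))\<^sup>2" for i x
    proof -
      have "norm (f x - F i x) \<le> 3 * norm (f x)"
        using norm_triangle_ineq4[of "f x" "F i x"] F(3)[of i x] by simp
      then have "(norm (f x - F i x))\<^sup>2 \<le> (3 * norm (f x))\<^sup>2" by (intro power_mono) auto
      then show ?thesis by (simp add: power_mult_distrib)
    qed
    then show "AE x in P. norm ((norm (f x - F i x))\<^sup>2) \<le> 9 * (norm (f x))\<^sup>2" for i by simp
  qed measurable
  then have "eventually (\<lambda>i. (\<integral>x. (norm (f x - F i x))\<^sup>2 \<partial>P) < e) sequentially"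
    using order_tendstoD(2) \<open>e > 0\<close> by fastforce
  then obtain i where "(\<integral>x. (norm (f x - F i x))\<^sup>2 \<partial>P) < e"
    unfolding eventually_sequentially by blast
  then show ?thesis using that[of "F i"] F by simp
qed

text \<open>Young's inequality, from expanding a square. The weight lets an error \<open>u\<close>
  with squared norm of order \<open>d\<^sup>2\<close> be paired with a merely bounded
  \<open>v\<close> at a total cost of order \<open>d\<close>.\<close>

lemma abs_inner_le_weighted:
  fixes u v :: "'h::real_inner"
  assumes "d > 0"
  shows "\<bar>inner u v\<bar> \<le> ((norm u)\<^sup>2 / d + d * (norm v)\<^sup>2) / 2"
proof -
  have "0 \<le> (norm u - d * norm v)\<^sup>2 / d" using assms by simp
  also have "\<dots> = (norm u)\<^sup>2 / d + d * (norm v)\<^sup>2 - 2 * (norm u * norm v)"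
    using assms by (simp add: power2_eq_square field_simps)
  finally show ?thesis using Cauchy_Schwarz_ineq2[of u v] by simp
qed

text \<open>The dominating function is a sum of functions of a single coordinate, so its
  integrability is a matter of the marginals alone.\<close>

lemma integrable_inner_couplings:
  fixes f :: "'a::second_countable_topology \<Rightarrow> 'h::{real_inner, second_countable_topology}"
    and g :: "'b::second_countable_topology \<Rightarrow> 'h"
  assumes \<pi>: "\<pi> \<in> couplings P Q"
    and f: "f \<in> borel_measurable borel" "integrable P (\<lambda>x. (norm (f x))\<^sup>2)"
    and g: "g \<in> borel_measurable borel" "integrable Q (\<lambda>y. (norm (g y))\<^sup>2)"
  shows "integrable \<pi> (\<lambda>z. inner (f (fst z)) (g (snd z)))"
proof (rule Bochner_Integration.integrable_bound)
  show "integrable \<pi> (\<lambda>z. (norm (f (fst z)))\<^sup>2 + (norm (g (snd z)))\<^sup>2)"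
    using integral_couplings(1)[OF \<pi> f(2)] integral_couplings(2)[OF \<pi> g(2)] f g by simp
  show "(\<lambda>z. inner (f (fst z)) (g (snd z))) \<in> borel_measurable \<pi>"
    using measurable_compose[OF measurable_couplings(1)[OF \<pi>] f(1)]
      measurable_compose[OF measurable_couplings(2)[OF \<pi>] g(1)] by (rule borel_measurable_inner)
  have "\<bar>inner u v\<bar> \<le> (norm u)\<^sup>2 + (norm v)\<^sup>2" for u v :: 'h
    using abs_inner_le_weighted[of 1 u v] by simp
  then show "AE z in \<pi>. norm (inner (f (fst z)) (g (snd z)))
      \<le> norm ((norm (f (fst z)))\<^sup>2 + (norm (g (snd z)))\<^sup>2)"
    by simp
qed

text \<open>The level sets of \<open>s\<close> and \<open>r\<close> cut the product into finitely
  many Borel rectangles on which the integrand is constant. The covariance thus depends only on the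
  rectangle masses, whose convergence is what a cluster point provides.\<close>

lemma integral_inner_simple_couplings:
  fixes s :: "'a::second_countable_topology \<Rightarrow> 'h::{real_inner, second_countable_topology}"
    and r :: "'b::second_countable_topology \<Rightarrow> 'h"
  assumes \<pi>: "\<pi> \<in> couplings P Q" and s: "simple_function borel s" and r: "simple_function borel r"
  shows "(\<integral>z. inner (s (fst z)) (r (snd z)) \<partial>\<pi>) =
    (\<Sum>u\<in>range s. \<Sum>v\<in>range r. inner u v * measure \<pi> ((s -` {u}) \<times> (r -` {v})))"
proof -
  interpret prob_space \<pi> using couplingsD[OF \<pi>] by blast
  have fin: "finite (range s)" "finite (range r)"
    using simple_functionD(1)[OF s] simple_functionD(1)[OF r] by auto
  have "s -` {u} \<in> sets borel" "r -` {v} \<in> sets borel" for u v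
    using simple_functionD(2)[OF s, of "{u}"] simple_functionD(2)[OF r, of "{v}"] by auto
  then have m: "(s -` {u}) \<times> (r -` {v}) \<in> sets \<pi>" for u v
    unfolding couplingsD(2)[OF \<pi>] borel_prod[symmetric] by (rule pair_measureI)
  have "inner (s (fst z)) (r (snd z)) =
    (\<Sum>u\<in>range s. \<Sum>v\<in>range r. inner u v * indicator ((s -` {u}) \<times> (r -` {v})) z)" for z
  proof -
    \<comment> \<open>The indicator of a rectangle of level sets is a product of two Kronecker
      deltas in \<open>u\<close> and \<open>v\<close>, which collapses the double sum.\<close>
    have "(\<Sum>u\<in>range s. \<Sum>v\<in>range r. inner u v * indicator ((s -` {u}) \<times> (r -` {v})) z) =
      (\<Sum>u\<in>range s. if u = s (fst z) then (\<Sum>v\<in>range r. if v = r (snd z) then inner u v else 0) else 0)"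
      by (intro sum.cong refl) (auto simp: indicator_def mem_Times_iff intro!: sum.cong sum.neutral)
    also have "\<dots> = inner (s (fst z)) (r (snd z))" using fin by simp
    finally show ?thesis by simp
  qed
  then have "(\<integral>z. inner (s (fst z)) (r (snd z)) \<partial>\<pi>) =
    (\<integral>z. (\<Sum>u\<in>range s. \<Sum>v\<in>range r. inner u v * indicator ((s -` {u}) \<times> (r -` {v})) z) \<partial>\<pi>)"
    by simp
  also have "\<dots> = (\<Sum>u\<in>range s. \<Sum>v\<in>range r. inner u v * measure \<pi> ((s -` {u}) \<times> (r -` {v})))"
    using m sets.Int_space_eq2[OF m]
    by (simp add: Bochner_Integration.integral_sum integrable_real_indicator emeasure_eq_measure)
  finally show ?thesis .
qed

text \<open>Replacing \<open>f\<close> and \<open>g\<close> by simple functions costs an error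
  bounded through the marginals, hence uniformly over every \<open>\<pi> n\<close> and
  \<open>\<mu>\<close>. For simple functions, convergence on finitely many rectangles
  suffices.\<close>

lemma tendsto_integral_inner_couplings:
  fixes f :: "'a::second_countable_topology \<Rightarrow> 'h::{real_inner, second_countable_topology}"
    and g :: "'b::second_countable_topology \<Rightarrow> 'h"
  assumes P: "sets P = sets borel" and Q: "sets Q = sets borel"
    and \<pi>: "\<And>n. \<pi> n \<in> couplings P Q" and \<mu>: "\<mu> \<in> couplings P Q"
    and lim: "\<forall>A\<in>sets borel. \<forall>B\<in>sets borel.
       ((\<lambda>n. measure (\<pi> n) (A \<times> B)) \<longlongrightarrow> measure \<mu> (A \<times> B)) G"
    and f: "f \<in> borel_measurable borel" "integrable P (\<lambda>x. (norm (f x))\<^sup>2)"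
    and g: "g \<in> borel_measurable borel" "integrable Q (\<lambda>y. (norm (g y))\<^sup>2)"
  shows "((\<lambda>n. \<integral>z. inner (f (fst z)) (g (snd z)) \<partial>\<pi> n) \<longlongrightarrow>
    (\<integral>z. inner (f (fst z)) (g (snd z)) \<partial>\<mu>)) G"
proof (rule tendstoI)
  fix e :: real assume "e > 0"
  \<comment> \<open>The approximation error will be at most \<open>d * C\<close>, which is
    \<open>e / 3\<close> for the \<open>d\<close> below. The 1 collects two errors of size
    \<open>d / 2\<close>; the factor 2 is half of the 4 obtained by squaring
    \<open>norm (s x) \<le> 2 * norm (f x)\<close>.\<close>
  define C where "C = 1 + 2 * (\<integral>x. (norm (f x))\<^sup>2 \<partial>P) + (\<integral>y. (norm (g y))\<^sup>2 \<partial>Q)"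
  have "C \<ge> 1" unfolding C_def by simp
  define d where "d = e / (3 * C)"
  have "d > 0" using \<open>e > 0\<close> \<open>C \<ge> 1\<close> by (simp add: d_def)
  \<comment> \<open>The tolerance is squared because Young's inequality divides it by
    \<open>d\<close>.\<close>
  then have "d\<^sup>2 > 0" by simp
  obtain s where s: "simple_function borel s" "\<And>x. norm (s x) \<le> 2 * norm (f x)"
    "(\<integral>x. (norm (f x - s x))\<^sup>2 \<partial>P) \<le> d\<^sup>2"
    using simple_function_L2_approx[OF P f \<open>d\<^sup>2 > 0\<close>] by blast
  obtain r where r: "simple_function borel r" "\<And>y. norm (r y) \<le> 2 * norm (g y)"
    "(\<integral>y. (norm (g y - r y))\<^sup>2 \<partial>Q) \<le> d\<^sup>2"
    using simple_function_L2_approx[OF Q g \<open>d\<^sup>2 > 0\<close>] by blast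
  note sm = borel_measurable_simple_function[OF s(1)] and rm = borel_measurable_simple_function[OF r(1)]
  have sq: "(norm (s x))\<^sup>2 \<le> 4 * (norm (f x))\<^sup>2" for x
    using power_mono[OF s(2)[of x], of 2] by (simp add: power_mult_distrib)
  have rq: "(norm (r x))\<^sup>2 \<le> 4 * (norm (g x))\<^sup>2" for x
    using power_mono[OF r(2)[of x], of 2] by (simp add: power_mult_distrib)
  have sP: "s \<in> borel_measurable P" "f \<in> borel_measurable P"
    using sm f unfolding measurable_cong_sets[OF P refl] by blast+
  have rQ: "r \<in> borel_measurable Q" "g \<in> borel_measurable Q"
    using rm g unfolding measurable_cong_sets[OF Q refl] by blast+
  have s_int: "integrable P (\<lambda>x. (norm (s x))\<^sup>2)"
    by (rule Bochner_Integration.integrable_bound[of P "\<lambda>x. 4 * (norm (f x))\<^sup>2"]) (use f sP sq in auto)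
  have r_int: "integrable Q (\<lambda>x. (norm (r x))\<^sup>2)"
    by (rule Bochner_Integration.integrable_bound[of Q "\<lambda>x. 4 * (norm (g x))\<^sup>2"]) (use g rQ rq in auto)
  \<comment> \<open>The parallelogram law with the square of \<open>norm (a + b)\<close>
    dropped.\<close>
  have par: "(norm (a - b))\<^sup>2 \<le> 2 * (norm a)\<^sup>2 + 2 * (norm b)\<^sup>2" for a b :: 'h
    using inner_ge_zero[of "a + b"]
    by (simp add: power2_norm_eq_inner inner_add_left inner_add_right inner_diff_left
        inner_diff_right inner_commute[of b a])
  have fs_int: "integrable P (\<lambda>x. (norm (f x - s x))\<^sup>2)"
    by (rule Bochner_Integration.integrable_bound[of P "\<lambda>x. 2 * (norm (f x))\<^sup>2 + 2 * (norm (s x))\<^sup>2"])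
       (use f s_int sP par in auto)
  have gr_int: "integrable Q (\<lambda>x. (norm (g x - r x))\<^sup>2)"
    by (rule Bochner_Integration.integrable_bound[of Q "\<lambda>x. 2 * (norm (g x))\<^sup>2 + 2 * (norm (r x))\<^sup>2"])
       (use g r_int rQ par in auto)
  let ?I = "\<lambda>\<rho>. \<integral>z. inner (f (fst z)) (g (snd z)) \<partial>\<rho>"
  let ?J = "\<lambda>\<rho>. \<integral>z. inner (s (fst z)) (r (snd z)) \<partial>\<rho>"
  have close: "\<bar>?I \<rho> - ?J \<rho>\<bar> \<le> e / 3" if \<rho>: "\<rho> \<in> couplings P Q" for \<rho>
  proof -
    \<comment> \<open>The sum of the Young bounds for the inner products of \<open>f - s\<close>
      with \<open>g\<close> and of \<open>g - r\<close> with \<open>s\<close>, the latter with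
      \<open>s\<close> estimated by \<open>f\<close>. Each summand involves one coordinate, so its
      integral reduces to a marginal.\<close>
    let ?D = "\<lambda>z. ((norm (f (fst z) - s (fst z)))\<^sup>2 / d + d * (norm (g (snd z)))\<^sup>2) / 2 +
      (d * (4 * (norm (f (fst z)))\<^sup>2) + (norm (g (snd z) - r (snd z)))\<^sup>2 / d) / 2"
    have fg: "integrable \<rho> (\<lambda>z. inner (f (fst z)) (g (snd z)))"
      and srI: "integrable \<rho> (\<lambda>z. inner (s (fst z)) (r (snd z)))"
      using integrable_inner_couplings[OF \<rho>] f g sm s_int rm r_int by auto
    note * = integral_couplings(1)[OF \<rho> fs_int] integral_couplings(1)[OF \<rho> f(2)]
      integral_couplings(2)[OF \<rho> gr_int] integral_couplings(2)[OF \<rho> g(2)]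
      integral_couplings(3)[OF \<rho>, of "\<lambda>x. (norm (f x - s x))\<^sup>2"]
      integral_couplings(3)[OF \<rho>, of "\<lambda>x. (norm (f x))\<^sup>2"]
      integral_couplings(4)[OF \<rho>, of "\<lambda>x. (norm (g x - r x))\<^sup>2"]
      integral_couplings(4)[OF \<rho>, of "\<lambda>x. (norm (g x))\<^sup>2"]
    have D: "integrable \<rho> ?D" using * f(1) g(1) sm rm by simp
    have "?I \<rho> - ?J \<rho> = (\<integral>z. inner (f (fst z)) (g (snd z)) - inner (s (fst z)) (r (snd z)) \<partial>\<rho>)"
      using fg srI by simp
    also have "\<bar>\<dots>\<bar> \<le> (\<integral>z. ?D z \<partial>\<rho>)"
    proof (rule order.trans[OF integral_abs_bound], rule integral_mono)
      fix z
      \<comment> \<open>The usual telescoping: first \<open>f\<close> is exchanged for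
        \<open>s\<close> against \<open>g\<close>, then \<open>g\<close> for \<open>r\<close>
        against \<open>s\<close>.\<close>
      have "inner (f (fst z)) (g (snd z)) - inner (s (fst z)) (r (snd z)) =
        inner (f (fst z) - s (fst z)) (g (snd z)) + inner (g (snd z) - r (snd z)) (s (fst z))"
        by (simp add: inner_diff_left inner_diff_right inner_commute)
      moreover have "d * (norm (s (fst z)))\<^sup>2 \<le> d * (4 * (norm (f (fst z)))\<^sup>2)"
        using sq \<open>d > 0\<close> by simp
      moreover have "x = u + v \<Longrightarrow> b' \<le> b \<Longrightarrow> \<bar>u\<bar> \<le> (p + q) / 2 \<Longrightarrow> \<bar>v\<bar> \<le> (a + b') / 2 \<Longrightarrow>
          \<bar>x\<bar> \<le> (p + q) / 2 + (b + a) / 2" for x u v p q a b b' :: real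
        by (simp add: abs_le_iff add_divide_distrib)
      ultimately show "\<bar>inner (f (fst z)) (g (snd z)) - inner (s (fst z)) (r (snd z))\<bar> \<le> ?D z"
        using abs_inner_le_weighted[OF \<open>d > 0\<close>, of "f (fst z) - s (fst z)" "g (snd z)"]
          abs_inner_le_weighted[OF \<open>d > 0\<close>, of "g (snd z) - r (snd z)" "s (fst z)"] by blast
    qed (use fg srI D in auto)
    also have "\<dots> = ((\<integral>x. (norm (f x - s x))\<^sup>2 \<partial>P) / d + d * (\<integral>y. (norm (g y))\<^sup>2 \<partial>Q)) / 2 +
      (d * (4 * (\<integral>x. (norm (f x))\<^sup>2 \<partial>P)) + (\<integral>y. (norm (g y - r y))\<^sup>2 \<partial>Q) / d) / 2"
      using * f(1) g(1) sm rm by simp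
    also have "\<dots> \<le> (d + d * (\<integral>y. (norm (g y))\<^sup>2 \<partial>Q)) / 2 + (d * (4 * (\<integral>x. (norm (f x))\<^sup>2 \<partial>P)) + d) / 2"
      using s(3) r(3) \<open>d > 0\<close>
      by (intro add_mono divide_right_mono order.refl) (auto simp: divide_le_eq power2_eq_square)
    also have "\<dots> \<le> d * C"
    proof -
      \<comment> \<open>Half of this quantity is the slack in the estimate by
        \<open>d * C\<close>.\<close>
      have "0 \<le> d * (\<integral>y. (norm (g y))\<^sup>2 \<partial>Q)" using \<open>d > 0\<close> by simp
      then show ?thesis unfolding C_def by argo
    qed
    also have "\<dots> = e / 3" using \<open>C \<ge> 1\<close> by (simp add: d_def)
    finally show ?thesis .
  qed
  have bor: "s -` {u} \<in> sets borel" "r -` {v} \<in> sets borel" for u v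
    using simple_functionD(2)[OF s(1), of "{u}"] simple_functionD(2)[OF r(1), of "{v}"] by auto
  have "((\<lambda>n. ?J (\<pi> n)) \<longlongrightarrow> ?J \<mu>) G"
    unfolding integral_inner_simple_couplings[OF \<pi> s(1) r(1)] integral_inner_simple_couplings[OF \<mu> s(1) r(1)]
    by (intro tendsto_intros lim[rule_format] bor)
  then have "eventually (\<lambda>n. dist (?J (\<pi> n)) (?J \<mu>) < e / 3) G"
    using \<open>e > 0\<close> by (intro tendstoD) auto
  then show "eventually (\<lambda>n. dist (?I (\<pi> n)) (?I \<mu>) < e) G"
  proof eventually_elim
    case (elim n)
    then show ?case using close[OF \<pi>[of n]] close[OF \<mu>] unfolding dist_real_def by linarith
  qed
qed

section \<open>Existence of an optimal coupling\<close>

text \<open>After expanding the square, the coupling enters through the covariance alone; the other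
  two terms are fixed by the marginals.\<close>

lemma integral_norm_diff_couplings:
  fixes f :: "'a::second_countable_topology \<Rightarrow> 'h::{real_inner, second_countable_topology}"
    and g :: "'b::second_countable_topology \<Rightarrow> 'h"
  assumes \<pi>: "\<pi> \<in> couplings P Q"
    and f: "f \<in> borel_measurable borel" "integrable P (\<lambda>x. (norm (f x))\<^sup>2)"
    and g: "g \<in> borel_measurable borel" "integrable Q (\<lambda>y. (norm (g y))\<^sup>2)"
  shows "(\<integral>z. (norm (f (fst z) - g (snd z)))\<^sup>2 \<partial>\<pi>) =
    (\<integral>x. (norm (f x))\<^sup>2 \<partial>P) + (\<integral>y. (norm (g y))\<^sup>2 \<partial>Q) - 2 * (\<integral>z. inner (f (fst z)) (g (snd z)) \<partial>\<pi>)"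
proof -
  have "(norm (f (fst z) - g (snd z)))\<^sup>2 =
    (norm (f (fst z)))\<^sup>2 + (norm (g (snd z)))\<^sup>2 - 2 * inner (f (fst z)) (g (snd z))" for z
    by (simp add: power2_norm_eq_inner inner_diff_left inner_diff_right inner_commute)
  then show ?thesis
    using integral_couplings(1)[OF \<pi> f(2)] integral_couplings(2)[OF \<pi> g(2)]
      integral_couplings(3)[OF \<pi>, of "\<lambda>x. (norm (f x))\<^sup>2"]
      integral_couplings(4)[OF \<pi>, of "\<lambda>x. (norm (g x))\<^sup>2"]
      integrable_inner_couplings[OF \<pi> f g] f(1) g(1) by simp
qed

text \<open>The direct method: a minimizing sequence has a cluster point, and with the marginals
  fixed the cost converges along the filter, not merely lower semicontinuously. The cluster point
  therefore attains the infimum.\<close>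

lemma quadratic_optimal_coupling:
  fixes P :: "'a::polish_space measure" and Q :: "'b::polish_space measure"
    and f :: "'a \<Rightarrow> 'h::{real_inner, second_countable_topology}" and g :: "'b \<Rightarrow> 'h"
  assumes P: "prob_space P" "sets P = sets borel" and Q: "prob_space Q" "sets Q = sets borel"
    and f: "f \<in> borel_measurable borel" "integrable P (\<lambda>x. (norm (f x))\<^sup>2)"
    and g: "g \<in> borel_measurable borel" "integrable Q (\<lambda>y. (norm (g y))\<^sup>2)"
  obtains \<mu> where "\<mu> \<in> couplings P Q"
    "(\<integral>z. (norm (f (fst z) - g (snd z)))\<^sup>2 \<partial>\<mu>) =
      (INF \<pi>\<in>couplings P Q. \<integral>z. (norm (f (fst z) - g (snd z)))\<^sup>2 \<partial>\<pi>)"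
proof -
  let ?c = "\<lambda>\<pi>. \<integral>z. (norm (f (fst z) - g (snd z)))\<^sup>2 \<partial>\<pi>"
  let ?W = "INF \<pi>\<in>couplings P Q. ?c \<pi>"
  have bdd: "bdd_below (?c ` couplings P Q)" by (rule bdd_belowI2[of _ 0]) simp
  have ne: "?c ` couplings P Q \<noteq> {}" using pair_measure_in_couplings[OF P Q] by blast
  \<comment> \<open>\<open>Suc n\<close> matters: at \<open>n = 0\<close> the term
    \<open>1 / real n\<close> would be 0, and no coupling has cost strictly below the
    infimum.\<close>
  have "\<forall>n. \<exists>\<pi>. \<pi> \<in> couplings P Q \<and> ?c \<pi> < ?W + 1 / real (Suc n)"
    using cInf_lessD[OF ne, of "?W + 1 / real (Suc n)" for n] by auto
  from choice[OF this] obtain \<pi> where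
    "\<forall>n. \<pi> n \<in> couplings P Q \<and> ?c (\<pi> n) < ?W + 1 / real (Suc n)" ..
  then have \<pi>: "\<And>n. \<pi> n \<in> couplings P Q" "\<And>n. ?c (\<pi> n) < ?W + 1 / real (Suc n)"
    by auto
  obtain G \<mu> where G: "G \<noteq> bot" "G \<le> sequentially" and \<mu>: "\<mu> \<in> couplings P Q"
    and lim: "\<forall>A\<in>sets borel. \<forall>B\<in>sets borel.
       ((\<lambda>n. measure (\<pi> n) (A \<times> B)) \<longlongrightarrow> measure \<mu> (A \<times> B)) G"
    using couplings_cluster_point[OF P Q \<pi>(1)] .
  have "((\<lambda>n. ?c (\<pi> n)) \<longlongrightarrow> ?c \<mu>) G"
    unfolding integral_norm_diff_couplings[OF \<pi>(1) f g] integral_norm_diff_couplings[OF \<mu> f g]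
    by (intro tendsto_intros tendsto_integral_inner_couplings[OF P(2) Q(2) \<pi>(1) \<mu> lim f g])
  \<comment> \<open>An ordinary sequential limit persists along \<open>G\<close>, as
    \<open>G\<close> refines \<open>sequentially\<close>.\<close>
  moreover have "(\<lambda>n. ?W + 1 / real (Suc n)) \<longlonglongrightarrow> ?W + 0"
    by (intro tendsto_intros LIMSEQ_Suc[OF lim_1_over_n])
  then have "((\<lambda>n. ?W + 1 / real (Suc n)) \<longlongrightarrow> ?W) G"
    using tendsto_mono[OF G(2)] by simp
  moreover have "eventually (\<lambda>n. ?c (\<pi> n) \<le> ?W + 1 / real (Suc n)) G"
    using \<pi>(2)[THEN less_imp_le] by (rule always_eventually[OF allI])
  ultimately have "?c \<mu> \<le> ?W"
    by (intro tendsto_le[OF G(1)])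
  moreover have "?W \<le> ?c \<mu>" by (rule cINF_lower[OF bdd \<mu>])
  ultimately show ?thesis using that[OF \<mu>] by linarith
qed

section \<open>Weighted second moments and the covariance bound\<close>

text \<open>Boundedness of \<open>S\<close> and the triangle inequality through the base point
  \<open>x0\<close> give \<open>norm (S x) \<le> K * (dist x x0 + norm x0)\<close>; the square of
  the sum is at most twice the sum of the squares, and constants are integrable under a probability
  measure.\<close>

lemma finite_second_moment_integrable_linear:
  fixes P :: "'h::{real_normed_vector, second_countable_topology} measure" and S :: "'h \<Rightarrow> 'k::real_normed_vector"
  assumes P: "P \<in> finite_second_moment" and S: "bounded_linear S"
  shows "integrable P (\<lambda>x. (norm (S x))\<^sup>2)"
proof -
  obtain x0 where pP: "prob_space P" "sets P = sets borel"
    and x0: "(\<integral>\<^sup>+ x. ennreal ((dist x x0)\<^sup>2) \<partial>P) < \<infinity>"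
    using P by (auto simp: finite_second_moment_def)
  interpret prob_space P by fact
  have cont: "continuous_on UNIV (\<lambda>x. (norm (S x))\<^sup>2)" "continuous_on UNIV (\<lambda>x. (dist x x0)\<^sup>2)"
    by (intro continuous_intros linear_continuous_on S)+
  have meas: "(\<lambda>x. (norm (S x))\<^sup>2) \<in> borel_measurable P" "(\<lambda>x. (dist x x0)\<^sup>2) \<in> borel_measurable P"
    using cont[THEN borel_measurable_continuous_onI]
    unfolding measurable_cong_sets[OF pP(2) refl] by blast+
  obtain K where K: "K > 0" "\<And>x. norm (S x) \<le> norm x * K"
    using bounded_linear.pos_bounded[OF S] by blast
  have int: "integrable P (\<lambda>x. (dist x x0)\<^sup>2)"
    using meas x0 by (intro integrableI_nonneg) auto
  show ?thesis
  proof (rule Bochner_Integration.integrable_bound)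
    show "integrable P (\<lambda>x. K\<^sup>2 * (2 * (dist x x0)\<^sup>2 + 2 * (norm x0)\<^sup>2))" using int by simp
    show "AE x in P. norm ((norm (S x))\<^sup>2) \<le> norm (K\<^sup>2 * (2 * (dist x x0)\<^sup>2 + 2 * (norm x0)\<^sup>2))"
    proof (rule AE_I2)
      fix x
      have "norm x \<le> dist x x0 + norm x0"
        by (metis dist_norm norm_triangle_sub add.commute)
      then have "norm (S x) \<le> K * (dist x x0 + norm x0)"
        using K by (smt (verit) mult.commute mult_left_mono)
      then have "(norm (S x))\<^sup>2 \<le> (K * (dist x x0 + norm x0))\<^sup>2" by (intro power_mono) auto
      also have "\<dots> \<le> K\<^sup>2 * (2 * (dist x x0)\<^sup>2 + 2 * (norm x0)\<^sup>2)"
        using sum_squares_bound[of "dist x x0" "norm x0"]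
        unfolding power_mult_distrib by (intro mult_left_mono) (auto simp: power2_sum)
      finally show "norm ((norm (S x))\<^sup>2) \<le> norm (K\<^sup>2 * (2 * (dist x x0)\<^sup>2 + 2 * (norm x0)\<^sup>2))"
        by simp
    qed
  qed (rule meas)
qed

theorem theorem1:
  fixes \<Gamma> S :: "'h::{real_inner, polish_space} \<Rightarrow> 'h"
    and t :: "'w::polish_space \<Rightarrow> 'h"
    and L \<tau>\<^sub>i \<tau>\<^sub>j :: real
    and \<U> :: "'u measure"
    and T \<epsilon>\<^sub>i \<epsilon>\<^sub>j :: "'w \<times> 'u \<Rightarrow> 'h"
    and C\<^sub>i C\<^sub>j :: "'w measure"
    and M\<^sub>i :: "'a measure" and M\<^sub>j :: "'b measure"
    and X\<^sub>i :: "'a \<Rightarrow> 'w" and X\<^sub>j :: "'b \<Rightarrow> 'w"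
    and U\<^sub>i :: "'a \<Rightarrow> 'u" and U\<^sub>j :: "'b \<Rightarrow> 'u"
    and B\<^sub>i :: "'a \<Rightarrow> 'h" and B\<^sub>j :: "'b \<Rightarrow> 'h"
    and P\<^sub>i P\<^sub>j :: "'h measure"
  assumes "pos_selfadjoint \<Gamma>"
    and "pos_sqrt \<Gamma> S"
    and "t \<in> borel \<rightarrow>\<^sub>M borel"
    and "borel_embedding (S \<circ> t)"
    and "L \<ge> 1"
    and "\<forall>x y. dist x y / L \<le> norm (S (t x) - S (t y)) \<and> norm (S (t x) - S (t y)) \<le> L * dist x y"
    and "T \<in> borel \<Otimes>\<^sub>M \<U> \<rightarrow>\<^sub>M borel"
    and "C\<^sub>i \<in> finite_second_moment" and "C\<^sub>j \<in> finite_second_moment"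
    and "prob_space M\<^sub>i" and "prob_space M\<^sub>j"
    and "indep_rvs M\<^sub>i borel X\<^sub>i \<U> U\<^sub>i" and "indep_rvs M\<^sub>j borel X\<^sub>j \<U> U\<^sub>j"
    and "distr M\<^sub>i borel X\<^sub>i = C\<^sub>i" and "distr M\<^sub>j borel X\<^sub>j = C\<^sub>j"
    and "distr M\<^sub>i \<U> U\<^sub>i = distr M\<^sub>j \<U> U\<^sub>j"
    and "B\<^sub>i = (\<lambda>\<omega>. T (X\<^sub>i \<omega>, U\<^sub>i \<omega>))" and "B\<^sub>j = (\<lambda>\<omega>. T (X\<^sub>j \<omega>, U\<^sub>j \<omega>))"
    and "\<epsilon>\<^sub>i \<in> borel \<Otimes>\<^sub>M \<U> \<rightarrow>\<^sub>M borel" and "\<epsilon>\<^sub>j \<in> borel \<Otimes>\<^sub>M \<U> \<rightarrow>\<^sub>M borel"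
    and "AE \<omega> in M\<^sub>i. B\<^sub>i \<omega> = t (X\<^sub>i \<omega>) + \<epsilon>\<^sub>i (X\<^sub>i \<omega>, U\<^sub>i \<omega>)"
    and "AE \<omega> in M\<^sub>j. B\<^sub>j \<omega> = t (X\<^sub>j \<omega>) + \<epsilon>\<^sub>j (X\<^sub>j \<omega>, U\<^sub>j \<omega>)"
    and "\<tau>\<^sub>i \<ge> 0" and "\<tau>\<^sub>j \<ge> 0"
    and "\<forall>x. \<forall>u \<in> space \<U>. norm (S (\<epsilon>\<^sub>i (x, u))) \<le> \<tau>\<^sub>i"
    and "\<forall>x. \<forall>u \<in> space \<U>. norm (S (\<epsilon>\<^sub>j (x, u))) \<le> \<tau>\<^sub>j"
    and "P\<^sub>i = distr M\<^sub>i borel B\<^sub>i" and "P\<^sub>j = distr M\<^sub>j borel B\<^sub>j"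
    and "P\<^sub>i \<in> finite_second_moment" and "P\<^sub>j \<in> finite_second_moment"
  shows "(\<forall>\<pi> \<in> couplings P\<^sub>i P\<^sub>j.
            coupling_cov S \<pi> = kappa_bar S P\<^sub>i P\<^sub>j - coupling_gap S P\<^sub>i P\<^sub>j \<pi> / 2 \<and>
            0 \<le> coupling_gap S P\<^sub>i P\<^sub>j \<pi>) \<and>
         (\<forall>\<pi> \<in> couplings P\<^sub>i P\<^sub>j. coupling_cov S \<pi> \<le> kappa_bar S P\<^sub>i P\<^sub>j) \<and>
         (\<exists>\<pi> \<in> couplings P\<^sub>i P\<^sub>j. coupling_cov S \<pi> = kappa_bar S P\<^sub>i P\<^sub>j)"
proof -
  note P\<^sub>i = assms(29) and P\<^sub>j = assms(30)
  have S: "bounded_linear S" using assms(2) by (simp add: pos_sqrt_def pos_selfadjoint_def)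
  then have Sm: "S \<in> borel_measurable borel"
    by (intro borel_measurable_continuous_onI linear_continuous_on)
  have prob: "prob_space P\<^sub>i" "sets P\<^sub>i = sets borel" "prob_space P\<^sub>j" "sets P\<^sub>j = sets borel"
    using P\<^sub>i P\<^sub>j by (auto simp: finite_second_moment_def)
  note L2 = Sm finite_second_moment_integrable_linear[OF P\<^sub>i S]
    Sm finite_second_moment_integrable_linear[OF P\<^sub>j S]
  have cost: "transport_cost S \<pi> = weighted_second_moment S P\<^sub>i + weighted_second_moment S P\<^sub>j
      - 2 * coupling_cov S \<pi>" if "\<pi> \<in> couplings P\<^sub>i P\<^sub>j" for \<pi>
    using integral_norm_diff_couplings[OF that L2]
    by (simp add: transport_cost_def weighted_second_moment_def coupling_cov_def case_prod_beta')
  have cov: "coupling_cov S \<pi> = kappa_bar S P\<^sub>i P\<^sub>j - coupling_gap S P\<^sub>i P\<^sub>j \<pi> / 2"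
    if "\<pi> \<in> couplings P\<^sub>i P\<^sub>j" for \<pi>
    using cost[OF that] by (simp add: kappa_bar_def coupling_gap_def field_simps)
  \<comment> \<open>A real infimum is a lower bound only for a family bounded below; costs are
    bounded by 0.\<close>
  have "bdd_below (transport_cost S ` couplings P\<^sub>i P\<^sub>j)"
    by (rule bdd_belowI2[of _ 0]) (simp add: transport_cost_def case_prod_beta')
  then have gap: "0 \<le> coupling_gap S P\<^sub>i P\<^sub>j \<pi>" if "\<pi> \<in> couplings P\<^sub>i P\<^sub>j" for \<pi>
    using that by (auto simp: coupling_gap_def weighted_W2_sq_def intro: cINF_lower)
  \<comment> \<open>At a cost minimizer the gap vanishes, so the identity \<open>cov\<close> turns
    optimality into attainment of \<open>kappa_bar\<close>.\<close>
  obtain \<mu> where "\<mu> \<in> couplings P\<^sub>i P\<^sub>j" "transport_cost S \<mu> = weighted_W2_sq S P\<^sub>i P\<^sub>j"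
    using quadratic_optimal_coupling[OF prob L2]
    unfolding transport_cost_def weighted_W2_sq_def case_prod_beta' by blast
  then have "\<mu> \<in> couplings P\<^sub>i P\<^sub>j" "coupling_cov S \<mu> = kappa_bar S P\<^sub>i P\<^sub>j"
    using cov[of \<mu>] by (simp_all add: coupling_gap_def)
  moreover have "coupling_cov S \<pi> \<le> kappa_bar S P\<^sub>i P\<^sub>j" if "\<pi> \<in> couplings P\<^sub>i P\<^sub>j" for \<pi>
    using cov[OF that] gap[OF that] by simp
  ultimately show ?thesis using cov gap by blast
qed

end
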